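(* Let $q$ be a prime power, $n\ge4$, $1\le s\le n-1$ with $\gcd(s,n)=1$, and $\delta\in\mathbb{F}_{q^n}$ with $\mathrm{N}_{q^n/q}(\delta)\notin\{0,1\}$. Then the linear set $L^{2,n}_{s,\delta}$ is not of pseudoregulus type. Moreover, for all $\delta,\rho\in\mathbb{F}_{q^8}$ with $\mathrm{N}_{q^8/q}(\delta),\mathrm{N}_{q^8/q}(\rho)\notin\{0,1\}$, the linear sets $L^{2,8}_{1,\delta}$ and $L^{2,8}_{3,\rho}$ are not $\mathrm{P\Gamma L}(2,q^8)$-equivalent.
   Context: For an $\mathbb{F}_q$-subspace $U$ of $\mathbb{F}_{q^n}^2$, the $\mathbb{F}_q$-linear set $L_U=\{\langle u\rangle_{\mathbb{F}_{q^n}} : u\in U\setminus\{0\}\}\subseteq \mathrm{PG}(1,q^n)$. $\mathrm{N}_{q^n/q}(\alpha)=\alpha^{1+q+\dots+q^{n-1}}$. $L^{2,n}_{s,\delta}$ is the linear set defined by $U^{2,n}_{s,\delta}=\{(x,\delta x^{q^s}+x^{q^{n-s}}) : x\in\mathbb{F}_{q^n}\}$. $L^{1,n}_{1}$ is the linear set defined by $U^{1,n}_1=\{(x,x^{q}) : x\in\mathbb{F}_{q^n}\}$. A linear set of $\mathrm{PG}(1,q^n)$ is of pseudoregulus type if it is $\mathrm{P\Gamma L}(2,q^n)$-equivalent to $L^{1,n}_1$. Two linear sets $L,L'$ are $\mathrm{P\Gamma L}(2,q^n)$-equivalent if $L^\phi=L'$ for some $\phi\in\mathrm{P\Gamma L}(2,q^n)$.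 *)

theory Defs
  imports "HOL-Analysis.Analysis" "HOL-Number_Theory.Number_Theory"
begin

(* Throughout, the type 'a is a finite field with CARD('a) = q ^ n; this is F_{q^n}, and its
   subfield F_q is the set of fixed points of x \<mapsto> x ^ q. *)

definition Fq :: "nat \<Rightarrow> 'a::{field,finite} set" where
  "Fq q = {c. c ^ q = c}"

definition Fq_subspace :: "nat \<Rightarrow> ('a::{field,finite} ^ 2) set \<Rightarrow> bool" where
  "Fq_subspace q U \<longleftrightarrow>
     0 \<in> U \<and> (\<forall>u\<in>U. \<forall>v\<in>U. u + v \<in> U) \<and> (\<forall>c\<in>Fq q. \<forall>u\<in>U. c *s u \<in> U)"

definition field_norm :: "nat \<Rightarrow> nat \<Rightarrow> 'a::{field,finite} \<Rightarrow> 'a" where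
  "field_norm q n a = a ^ (\<Sum>i<n. q ^ i)"

definition PG1 :: "('a::{field,finite} ^ 2) set set" where
  "PG1 = {vec.span {v} | v. v \<noteq> 0}"

(* Only used for F_q-subspaces U, see the lemmas Fq_subspace_U1 and Fq_subspace_U2 below. *)
definition linear_set :: "('a::{field,finite} ^ 2) set \<Rightarrow> ('a ^ 2) set set" where
  "linear_set U = {vec.span {u} | u. u \<in> U - {0}}"

definition U1 :: "nat \<Rightarrow> ('a::{field,finite} ^ 2) set" where
  "U1 q = {vector [x, x ^ q] | x. True}"

definition U2 :: "nat \<Rightarrow> nat \<Rightarrow> nat \<Rightarrow> 'a::{field,finite} \<Rightarrow> ('a ^ 2) set" where
  "U2 q n s \<delta> = {vector [x, \<delta> * x ^ (q ^ s) + x ^ (q ^ (n - s))] | x. True}"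

definition L1 :: "nat \<Rightarrow> ('a::{field,finite} ^ 2) set set" where
  "L1 q = linear_set (U1 q)"

definition L2 :: "nat \<Rightarrow> nat \<Rightarrow> nat \<Rightarrow> 'a::{field,finite} \<Rightarrow> ('a ^ 2) set set" where
  "L2 q n s \<delta> = linear_set (U2 q n s \<delta>)"

definition field_automorphism :: "('a::{field,finite} \<Rightarrow> 'a) \<Rightarrow> bool" where
  "field_automorphism \<sigma> \<longleftrightarrow>
     bij \<sigma> \<and> (\<forall>x y. \<sigma> (x + y) = \<sigma> x + \<sigma> y) \<and> (\<forall>x y. \<sigma> (x * y) = \<sigma> x * \<sigma> y)"

definition GammaL2 :: "('a::{field,finite} ^ 2 \<Rightarrow> 'a ^ 2) set" where
  "GammaL2 = {f. bij f \<and> (\<forall>u v. f (u + v) = f u + f v) \<and>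
     (\<exists>\<sigma>. field_automorphism \<sigma> \<and> (\<forall>c v. f (c *s v) = \<sigma> c *s f v))}"

(* The quotient of GammaL2 by the scalars, realised as its faithful action on the points of the
   projective line. *)
definition PGammaL2 :: "(('a::{field,finite} ^ 2) set \<Rightarrow> ('a ^ 2) set) set" where
  "PGammaL2 = {restrict (\<lambda>P. f ` P) PG1 | f. f \<in> GammaL2}"

definition PGammaL2_equivalent ::
    "('a::{field,finite} ^ 2) set set \<Rightarrow> ('a ^ 2) set set \<Rightarrow> bool" where
  "PGammaL2_equivalent L L' \<longleftrightarrow> (\<exists>\<phi>\<in>PGammaL2. \<phi> ` L = L')"

definition pseudoregulus_type :: "nat \<Rightarrow> ('a::{field,finite} ^ 2) set set \<Rightarrow> bool" where
  "pseudoregulus_type q L \<longleftrightarrow> PGammaL2_equivalent L (L1 q)"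

lemma Frobenius_add:
  fixes x y :: "'a::{field,finite}"
  assumes "primepow q" and card: "CARD('a) = q ^ n"
  shows "(x + y) ^ (q ^ k) = x ^ (q ^ k) + y ^ (q ^ k)"
proof -
  obtain p m where p: "prime p" "q = p ^ m"
    using assms(1) by (auto simp: primepow_def)
  have C: "prime CHAR('a)"
    using prime_CHAR_semidom[where ?'a='a] finite_imp_CHAR_pos[where ?'a='a] by simp
  have "CHAR('a) dvd p ^ (m * n)"
    using CHAR_dvd_CARD[where ?'a='a] card p(2) by (simp add: power_mult)
  hence "CHAR('a) = p"
    using C p(1) prime_dvd_power primes_dvd_imp_eq by blast
  thus ?thesis
    using freshmans_dream'[where ?'a='a, OF C, of "q ^ k" "m * k" x y] p(2)
    by (simp add: power_mult)
qed

lemma Fq_power: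
  assumes "c \<in> Fq q"
  shows "c ^ (q ^ k) = c"
  using assms by (induction k) (auto simp: Fq_def power_mult)

lemma Fq_subspace_U1:
  assumes "primepow q" and card: "CARD('a::{field,finite}) = q ^ n"
  shows "Fq_subspace q (U1 q :: ('a ^ 2) set)"
proof -
  have q: "q > 0"
    using assms(1) by (auto simp: primepow_def prime_gt_0_nat)
  have "(0 :: 'a ^ 2) \<in> U1 q"
    using q by (auto simp: U1_def vec_eq_iff forall_2 intro!: exI[of _ 0])
  moreover have "u + v \<in> U1 q" if "u \<in> U1 q" "v \<in> U1 q" for u v :: "'a ^ 2"
  proof -
    from that obtain x y where "u = vector [x, x ^ q]" "v = vector [y, y ^ q]"
      by (auto simp: U1_def)
    then have "u + v = vector [x + y, (x + y) ^ q]"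
      using Frobenius_add[OF assms, of x y 1] by (simp add: vec_eq_iff forall_2)
    thus ?thesis by (auto simp: U1_def)
  qed
  moreover have "c *s u \<in> U1 q" if "c \<in> Fq q" "u \<in> U1 q" for c and u :: "'a ^ 2"
  proof -
    from that obtain x where "u = vector [x, x ^ q]"
      by (auto simp: U1_def)
    then have "c *s u = vector [c * x, (c * x) ^ q]"
      using that(1) by (simp add: vec_eq_iff forall_2 Fq_def power_mult_distrib)
    thus ?thesis by (auto simp: U1_def)
  qed
  ultimately show ?thesis
    unfolding Fq_subspace_def by blast
qed

lemma Fq_subspace_U2:
  fixes \<delta> :: "'a::{field,finite}"
  assumes "primepow q" and card: "CARD('a) = q ^ n"
  shows "Fq_subspace q (U2 q n s \<delta>)"
proof -
  let ?g = "\<lambda>x. \<delta> * x ^ (q ^ s) + x ^ (q ^ (n - s))"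
  have q: "q > 0"
    using assms(1) by (auto simp: primepow_def prime_gt_0_nat)
  have "0 \<in> U2 q n s \<delta>"
    using q by (auto simp: U2_def vec_eq_iff forall_2 power_0_left intro!: exI[of _ 0])
  moreover have "u + v \<in> U2 q n s \<delta>" if "u \<in> U2 q n s \<delta>" "v \<in> U2 q n s \<delta>" for u v
  proof -
    from that obtain x y where "u = vector [x, ?g x]" "v = vector [y, ?g y]"
      by (auto simp: U2_def)
    then have "u + v = vector [x + y, ?g (x + y)]"
      by (simp add: Frobenius_add[OF assms] vec_eq_iff forall_2 algebra_simps)
    thus ?thesis by (auto simp: U2_def)
  qed
  moreover have "c *s u \<in> U2 q n s \<delta>" if "c \<in> Fq q" "u \<in> U2 q n s \<delta>" for c u
  proof -
    from that obtain x where "u = vector [x, ?g x]"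
      by (auto simp: U2_def)
    then have "c *s u = vector [c * x, ?g (c * x)]"
      using that(1)
      by (simp add: vec_eq_iff forall_2 Fq_power power_mult_distrib algebra_simps)
    thus ?thesis by (auto simp: U2_def)
  qed
  ultimately show ?thesis
    unfolding Fq_subspace_def by blast
qed

end

theory Submission
  imports Defs
begin

text \<open>
  If \<open>f\<close> and \<open>h\<close> are linearized polynomials with coefficients \<open>a\<^sub>i\<close> and \<open>h\<^sub>i\<close> and the ratios
  \<open>f x / x\<close> and \<open>h x / x\<close> form the same set, then comparing the sums of their powers with exponents
  \<open>1\<close> and \<open>1 + q\<^sup>k\<close> gives \<open>a\<^sub>k a\<^sub>n\<^sub>-\<^sub>k ^ q\<^sup>k = h\<^sub>k h\<^sub>n\<^sub>-\<^sub>k ^ q\<^sup>k\<close> for \<open>0 < k < n\<close>.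

  An equivalence of the linear sets of \<open>f\<close> and \<open>g\<close> amounts, after twisting \<open>f\<close> by a field automorphism,
  to an equality of this kind in which \<open>h\<close> is either \<open>c x + e g (d x)\<close> or \<open>\<alpha> x + \<beta> P\<^sup>-\<^sup>1 x\<close> with
  \<open>P x = D x - B g x\<close> and \<open>B \<noteq> 0\<close>. Comparing coefficients in \<open>P \<circ> P\<^sup>-\<^sup>1 = id\<close> yields a recurrence for
  the coefficients of \<open>P\<^sup>-\<^sup>1\<close>, whose solutions have a pattern of zeros that is incompatible with the
  relations above: for \<open>f\<close> these say that \<open>a\<^sub>k a\<^sub>n\<^sub>-\<^sub>k \<noteq> 0\<close> exactly for \<open>k \<in> {s, n - s}\<close>.
\<close>

section \<open>Power sums over finite fields\<close>

text \<open>Multiplication by \<open>y\<close> permutes the nonzero elements and multiplies the sum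
  by \<open>y ^ e\<close>, which differs from 1.\<close>

lemma sum_power_nonzero_eq_0:
  fixes y :: "'a::{field,finite}"
  assumes "y \<noteq> 0" "y ^ e \<noteq> 1"
  shows "(\<Sum>x\<in>-{0::'a}. x ^ e) = 0"
proof -
  have "bij_betw ((*) y) (-{0}) (-{0})"
    using assms(1) by (intro bij_betwI[of _ _ _ "\<lambda>x. x / y"]) auto
  hence "(\<Sum>x\<in>-{0}. x ^ e) = (\<Sum>x\<in>-{0}. (y * x) ^ e)"
    by (rule sum.reindex_bij_betw[symmetric])
  also have "\<dots> = y ^ e * (\<Sum>x\<in>-{0}. x ^ e)"
    by (simp add: power_mult_distrib sum_distrib_left)
  finally have "(1 - y ^ e) * (\<Sum>x\<in>-{0}. x ^ e) = 0"
    by (simp add: algebra_simps)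
  thus ?thesis using assms(2) by simp
qed

lemma power_card_minus_1_eq_1:
  fixes x :: "'a::{field,finite}"
  assumes "x \<noteq> 0"
  shows "x ^ (CARD('a) - 1) = 1"
proof -
  have "(\<Prod>y\<in>-{0}. y) = (\<Prod>y\<in>-{0}. x * y)"
    by (rule prod.reindex_bij_witness[of _ "\<lambda>y. x * y" "\<lambda>y. y / x"]) (use assms in auto)
  also have "\<dots> = x ^ (CARD('a) - 1) * (\<Prod>y\<in>-{0}. y)"
    by (simp add: prod.distrib card_Diff_singleton Compl_eq_Diff_UNIV)
  finally show ?thesis by (simp add: Compl_eq_Diff_UNIV)
qed

text \<open>\<open>X ^ e - 1\<close> has at most \<open>e\<close> roots, fewer than there are
  nonzero elements.\<close>

lemma exists_power_neq_1:
  assumes "0 < e" "e < CARD('a::{field,finite}) - 1"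
  obtains y :: "'a::{field,finite}" where "y \<noteq> 0" "y ^ e \<noteq> 1"
proof -
  let ?p = "Polynomial.monom 1 e - 1 :: 'a poly"
  have d: "degree ?p \<le> e"
    by (intro degree_diff_le) (auto simp: degree_monom_le)
  have "Polynomial.coeff ?p e = 1" using assms by simp
  hence "?p \<noteq> 0" by (metis coeff_0 zero_neq_one)
  hence "card {x. poly ?p x = 0} \<le> e"
    using card_poly_roots_bound[of ?p] d by (meson le_trans)
  moreover have "card (-{0::'a}) = CARD('a) - 1"
    by (simp add: card_Diff_singleton Compl_eq_Diff_UNIV)
  ultimately have "\<not> -{0} \<subseteq> {x. poly ?p x = 0}"
    using assms card_mono[of "{x. poly ?p x = 0}" "-{0::'a}"] by auto
  thus ?thesis using that by (auto simp: poly_monom)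
qed

text \<open>In the divisible case all summands are 1, and there are \<open>CARD('a) - 1\<close> of
  them, which is -1 in the field. Otherwise some nonzero \<open>y\<close> has \<open>y ^ e\<close>
  different from 1; it is found after reducing \<open>e\<close> modulo
  \<open>CARD('a) - 1\<close>.\<close>

lemma sum_power_nonzero:
  "(\<Sum>x\<in>-{0::'a::{field,finite}}. x ^ e) = (if (CARD('a) - 1) dvd e then -1 else 0)"
proof (cases "(CARD('a) - 1) dvd e")
  case True
  have "x ^ e = 1" if "x \<noteq> 0" for x :: 'a
    using True power_card_minus_1_eq_1[OF that] by (auto simp: power_mult elim!: dvdE)
  hence "(\<Sum>x\<in>-{0::'a}. x ^ e) = of_nat (card (-{0::'a}))" by simp
  also have "\<dots> = of_nat (CARD('a)) - 1"
    by (simp add: card_Diff_singleton Compl_eq_Diff_UNIV of_nat_diff)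
  also have "\<dots> = -1"
    using CHAR_dvd_CARD[where ?'a='a] by (simp add: of_nat_eq_0_iff_char_dvd)
  finally show ?thesis using True by simp
next
  case False
  let ?r = "e mod (CARD('a) - 1)"
  have "CARD('a) \<ge> card {0, 1 :: 'a}" by (intro card_mono) auto
  hence "CARD('a) - 1 > 0" by simp
  hence "0 < ?r" "?r < CARD('a) - 1"
    using False by (auto simp: dvd_eq_mod_eq_0)
  then obtain y :: 'a where y: "y \<noteq> 0" "y ^ ?r \<noteq> 1"
    by (rule exists_power_neq_1)
  have "y ^ e = (y ^ (CARD('a) - 1)) ^ (e div (CARD('a) - 1)) * y ^ ?r"
    by (simp flip: power_mult power_add)
  hence "y ^ e \<noteq> 1"
    using y power_card_minus_1_eq_1[of y] by simp
  thus ?thesis using sum_power_nonzero_eq_0[of y e] y False by simp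
qed

text \<open>Translating the sum of all elements of \<open>K\<close> by \<open>u\<close> adds \<open>card K\<close> times \<open>u\<close>.\<close>

lemma of_nat_card_additive_subgroup:
  fixes K :: "'a::{field,finite} set"
  assumes "u \<in> K" "u \<noteq> 0" and add: "\<And>x y. x \<in> K \<Longrightarrow> y \<in> K \<Longrightarrow> x + y \<in> K"
    and uminus: "\<And>x. x \<in> K \<Longrightarrow> - x \<in> K"
  shows "of_nat (card K) = (0 :: 'a)"
proof -
  have "bij_betw ((+) u) K K"
  proof (rule bij_betwI[of _ _ _ "(+) (- u)"])
    show "(+) u \<in> K \<rightarrow> K" "(+) (- u) \<in> K \<rightarrow> K"
      using add assms(1) uminus by (auto simp del: add_uminus_conv_diff)
  qed auto
  hence "(\<Sum>x\<in>K. x) = (\<Sum>x\<in>K. u + x)"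
    by (rule sum.reindex_bij_betw[symmetric])
  also have "\<dots> = of_nat (card K) * u + (\<Sum>x\<in>K. x)"
    by (simp add: sum.distrib)
  finally show ?thesis using assms(2) by simp
qed

section \<open>Slopes of additive maps and their power sums\<close>

text \<open>The affine coordinates of the points spanned by \<open>(x, f x)\<close>. If
  \<open>f 0 = 0\<close>, the point at infinity does not occur, so the slopes determine the linear
  set.\<close>

definition slopes :: "('a::field \<Rightarrow> 'a) \<Rightarrow> 'a set" where
  "slopes f = {f x / x | x. x \<noteq> 0}"

lemma slopes_reindex:
  assumes "surj p" "\<And>y. p y = 0 \<longleftrightarrow> y = 0"
  shows "slopes f = {f (p y) / p y | y. y \<noteq> 0}"
  unfolding slopes_def using assms by (metis (no_types, lifting) surjD)

text \<open>A slope is attained on a subgroup without \<open>0\<close>, i.e. \<open>-1\<close> times modulo the characteristic;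
  so the power sums do not see the weights of the points of the linear set.\<close>

lemma sum_slopes:
  fixes f :: "'a::{field,finite} \<Rightarrow> 'a"
  assumes "Modules.additive f"
  shows "(\<Sum>x\<in>-{0}. (f x / x) ^ d) = - (\<Sum>v\<in>slopes f. v ^ d)"
proof -
  interpret Modules.additive f by fact
  have fib: "of_nat (card {x\<in>-{0}. f x / x = v}) = (-1 :: 'a)" if v: "v \<in> slopes f" for v
  proof -
    let ?K = "{x. f x = v * x}"
    obtain u where u: "u \<noteq> 0" "v = f u / u" using v by (auto simp: slopes_def)
    have "of_nat (card ?K) = (0 :: 'a)"
      by (rule of_nat_card_additive_subgroup[of u]) (use u in \<open>auto simp: add minus ring_distribs add_divide_distrib\<close>)
    moreover have "{x\<in>-{0}. f x / x = v} = ?K - {0}"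
      by (auto simp: field_simps)
    moreover have "0 \<in> ?K" by (simp add: zero)
    moreover have "card ?K > 0" using \<open>0 \<in> ?K\<close> by (metis card_gt_0_iff empty_iff finite)
    ultimately show ?thesis by (simp add: card_Diff_singleton of_nat_diff)
  qed
  have "(\<Sum>x\<in>-{0}. (f x / x) ^ d) = (\<Sum>v\<in>slopes f. \<Sum>x\<in>{x\<in>-{0}. f x / x = v}. (f x / x) ^ d)"
    by (rule sum.group[symmetric]) (auto simp: slopes_def)
  also have "\<dots> = (\<Sum>v\<in>slopes f. - (v ^ d))"
  proof (rule sum.cong)
    fix v assume v: "v \<in> slopes f"
    have "(\<Sum>x\<in>{x\<in>-{0}. f x / x = v}. (f x / x) ^ d) = (\<Sum>x\<in>{x\<in>-{0}. f x / x = v}. v ^ d)"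
      by (rule sum.cong) auto
    thus "(\<Sum>x\<in>{x\<in>-{0}. f x / x = v}. (f x / x) ^ d) = - (v ^ d)"
      using fib[OF v] by simp
  qed simp
  finally show ?thesis by (simp add: sum_negf)
qed

section \<open>Linearized polynomials\<close>

text \<open>The right side is 1 modulo \<open>q\<close>, so one of the exponents on the left is 0;
  then the summand 1 cancels.\<close>

lemma sum_two_powers_eq:
  fixes q i j k :: nat
  assumes "q \<ge> 2" "k \<ge> 1" and eq: "q ^ i + q ^ j = 1 + q ^ k"
  shows "(i = 0 \<and> j = k) \<or> (i = k \<and> j = 0)"
proof -
  have "\<not> (i \<noteq> 0 \<and> j \<noteq> 0)"
  proof
    assume "i \<noteq> 0 \<and> j \<noteq> 0"
    hence "q dvd q ^ i + q ^ j" by (auto intro!: dvd_add dvd_power)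
    hence "q dvd 1 + q ^ k" using eq by simp
    moreover have "q dvd q ^ k" using assms(2) by (auto intro!: dvd_power)
    ultimately have "q dvd 1" by (metis dvd_add_left_iff)
    thus False using assms(1) by simp
  qed
  thus ?thesis using eq assms(1) by auto
qed

text \<open>The bounds place \<open>a + (M - b)\<close> strictly between 0 and \<open>2 * M\<close>,
  so \<open>M\<close> is the only multiple it can equal. With \<open>M = q ^ n - 1\<close> this
  decides which exponents survive in a power sum.\<close>

lemma dvd_add_diff_iff_eq:
  fixes M a b :: nat
  assumes "a < M + b" "b \<le> M" "b < M + a"
  shows "M dvd a + (M - b) \<longleftrightarrow> a = b"
proof
  assume "M dvd a + (M - b)"
  then obtain k where k: "a + (M - b) = M * k" by (rule dvdE)
  have "k = 1"
  proof (rule ccontr)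
    assume "k \<noteq> 1"
    then consider "k = 0" | "k \<ge> 2" by linarith
    thus False
    proof cases
      case 2
      hence "M * k \<ge> M * 2" by simp
      thus False using k assms by linarith
    qed (use k assms in auto)
  qed
  thus "a = b" using k assms by simp
qed (use assms in auto)

text \<open>The argument \<open>ty\<close> pins the field type, so that the locale can be
  interpreted for both types of the theorem.\<close>

locale field_extension =
  fixes q n :: nat and ty :: "'a::{field,finite} itself"
  assumes primepow: "primepow q" and card: "CARD('a) = q ^ n"
begin

lemma q_ge_2: "q \<ge> 2"
  using primepow primepow_gt_Suc_0 by fastforce

lemma n_pos: "n > 0"
proof (rule ccontr)
  assume "\<not> n > 0"
  hence "CARD('a) = 1" using card by simp
  moreover have "CARD('a) \<ge> card {0, 1 :: 'a}" by (intro card_mono) auto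
  ultimately show False by simp
qed

lemmas frob_add = Frobenius_add[OF primepow card]

lemma frob_0 [simp]: "(0::'a) ^ (q ^ k) = 0"
  using q_ge_2 by simp

lemma frob_sum: "(\<Sum>i\<in>A. f i :: 'a) ^ (q ^ k) = (\<Sum>i\<in>A. f i ^ (q ^ k))"
  by (induction A rule: infinite_finite_induct) (auto simp: frob_add)

lemma frob_n [simp]: "(x::'a) ^ (q ^ n) = x"
proof (cases "x = 0")
  case False
  have "q ^ n > 0" using q_ge_2 by simp
  hence "x ^ (q ^ n) = x * x ^ (q ^ n - 1)" by (simp flip: power_Suc)
  thus ?thesis using power_card_minus_1_eq_1[OF False] card by simp
qed simp

lemma frob_add_n: "(x::'a) ^ (q ^ (n + k)) = x ^ (q ^ k)"
  by (simp add: power_add power_mult)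

lemma frob_mod: "(x::'a) ^ (q ^ k) = x ^ (q ^ (k mod n))"
proof -
  have "x ^ (q ^ (n * m + k)) = x ^ (q ^ k)" for m k
    by (induction m) (simp_all add: frob_add_n add.assoc)
  from this[of "k div n" "k mod n"] show ?thesis by simp
qed

text \<open>Indices below \<open>n\<close> suffice because \<open>x ^ (q ^ n) = x\<close>; values of
  \<open>a\<close> from \<open>n\<close> on are ignored.\<close>

definition qpoly :: "(nat \<Rightarrow> 'a) \<Rightarrow> 'a \<Rightarrow> 'a" where
  "qpoly a x = (\<Sum>i<n. a i * x ^ (q ^ i))"

lemma additive_qpoly: "Modules.additive (qpoly a)"
  by (rule Modules.additive.intro) (simp add: qpoly_def frob_add sum.distrib algebra_simps)

lemma qpoly_add: "qpoly a x + qpoly b x = qpoly (\<lambda>i. a i + b i) x"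
  by (simp add: qpoly_def sum.distrib algebra_simps)

lemma qpoly_diff: "qpoly a x - qpoly b x = qpoly (\<lambda>i. a i - b i) x"
  by (simp add: qpoly_def sum_subtractf algebra_simps)

lemma qpoly_scale: "c * qpoly a x = qpoly (\<lambda>i. c * a i) x"
  by (simp add: qpoly_def sum_distrib_left algebra_simps)

lemma qpoly_monom:
  assumes "k < n"
  shows "c * x ^ (q ^ k) = qpoly (\<lambda>i. if i = k then c else 0) x"
  using assms by (simp add: qpoly_def if_distrib[of "\<lambda>t. t * _"] cong: if_cong)

lemma qpoly_linear: "c * x = qpoly (\<lambda>i. if i = 0 then c else 0) x"
  using qpoly_monom[of 0 c x] n_pos by simp

section \<open>Frobenius powers, composition and inverses\<close>

lemma shift_mod_inverse:
  assumes "k \<le> n" "i < n"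
  shows "((i + k) mod n + (n - k)) mod n = i"
proof -
  have "((i + k) mod n + (n - k)) mod n = (i + k + (n - k)) mod n"
    by (rule mod_add_left_eq)
  also have "i + k + (n - k) = i + n" using assms by simp
  finally show ?thesis using assms by simp
qed

text \<open>Indices are cyclic modulo \<open>n\<close>. The shift back by \<open>k\<close> is
  written as adding \<open>n - k\<close>, which avoids truncated subtraction.\<close>

lemma bij_betw_shift_mod:
  assumes "k \<le> n"
  shows "bij_betw (\<lambda>i. (i + k) mod n) {..<n} {..<n}"
proof (rule bij_betwI[of _ _ _ "\<lambda>i. (i + (n - k)) mod n"])
  fix i assume i: "i \<in> {..<n}"
  show "((i + k) mod n + (n - k)) mod n = i"
    using shift_mod_inverse[of k i] assms i by simp
  show "((i + (n - k)) mod n + k) mod n = i"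
    using shift_mod_inverse[of "n - k" i] assms i by simp
qed (use n_pos in auto)

text \<open>Raising to the power \<open>q ^ k\<close> is additive and moves the term of index
  \<open>i\<close> to index \<open>i + k\<close> modulo \<open>n\<close>, so the new coefficient at
  \<open>i\<close> comes from \<open>i - k\<close>.\<close>

lemma qpoly_frob:
  assumes "k \<le> n"
  shows "qpoly a x ^ (q ^ k) = qpoly (\<lambda>i. a ((i + (n - k)) mod n) ^ (q ^ k)) x"
proof -
  have "qpoly (\<lambda>i. a ((i + (n - k)) mod n) ^ (q ^ k)) x =
        (\<Sum>i<n. a (((i + k) mod n + (n - k)) mod n) ^ (q ^ k) * x ^ (q ^ ((i + k) mod n)))"
    unfolding qpoly_def
    by (rule sum.reindex_bij_betw[OF bij_betw_shift_mod[OF assms], symmetric])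
  also have "\<dots> = (\<Sum>i<n. a i ^ (q ^ k) * x ^ (q ^ (i + k)))"
  proof (rule sum.cong)
    fix i assume "i \<in> {..<n}"
    hence i: "i < n" by simp
    have "((i + k) mod n + (n - k)) mod n = i" by (rule shift_mod_inverse[OF assms i])
    thus "a (((i + k) mod n + (n - k)) mod n) ^ (q ^ k) * x ^ (q ^ ((i + k) mod n)) =
          a i ^ (q ^ k) * x ^ (q ^ (i + k))"
      by (simp add: frob_mod[symmetric])
  qed simp
  also have "\<dots> = qpoly a x ^ (q ^ k)"
    by (simp add: qpoly_def frob_sum power_mult_distrib power_add power_mult)
  finally show ?thesis by simp
qed

lemma qpoly_sum: "(\<Sum>j\<in>A. qpoly (a j) x) = qpoly (\<lambda>i. \<Sum>j\<in>A. a j i) x"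
  by (simp add: qpoly_def sum_distrib_right sum.swap[of _ _ A])

text \<open>Each Frobenius power of the inner polynomial is again linearized. Existence of
  coefficients is enough for describing iterates.\<close>

lemma qpoly_comp: "\<exists>c. \<forall>x. qpoly a (qpoly b x) = qpoly c x"
proof -
  have "qpoly a (qpoly b x) =
      qpoly (\<lambda>i. \<Sum>j<n. a j * b ((i + (n - j)) mod n) ^ (q ^ j)) x" for x
  proof -
    have "qpoly a (qpoly b x) = (\<Sum>j<n. a j * qpoly b x ^ (q ^ j))"
      by (simp add: qpoly_def)
    also have "\<dots> = (\<Sum>j<n. qpoly (\<lambda>i. a j * b ((i + (n - j)) mod n) ^ (q ^ j)) x)"
      by (rule sum.cong) (simp_all add: qpoly_frob qpoly_scale)
    finally show ?thesis by (simp add: qpoly_sum)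
  qed
  thus ?thesis by blast
qed

text \<open>A permutation of a finite set has finite order, so its inverse is one of its powers.\<close>

lemma qpoly_inverse:
  assumes "inj (qpoly a)"
  obtains h where "\<And>x. qpoly a (qpoly h x) = x" "\<And>x. qpoly h (qpoly a x) = x"
proof -
  let ?f = "qpoly a"
  have comp: "\<exists>c. \<forall>x. (?f ^^ m) x = qpoly c x" for m
  proof (induction m)
    case 0
    show ?case using qpoly_linear[of 1] by auto
  next
    case (Suc m)
    thus ?case using qpoly_comp by fastforce
  qed
  have "\<not> inj (\<lambda>m::nat. ?f ^^ m)"
    using finite_imageD[of "\<lambda>m::nat. ?f ^^ m" UNIV] by auto
  then obtain i j where ij: "?f ^^ i = ?f ^^ j" "i < j"
    unfolding inj_def by (metis nat_neq_iff)
  have "inj (?f ^^ i)" using assms by (rule inj_fn)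
  moreover have "(?f ^^ i) ((?f ^^ (j - i)) x) = (?f ^^ i) x" for x
    using ij by (metis add.commute comp_apply funpow_add le_add_diff_inverse2 less_imp_le)
  ultimately have id: "(?f ^^ (j - i)) x = x" for x by (meson injD)
  \<comment> \<open>The iterate with exponent \<open>j - i - 1\<close> is the inverse.\<close>
  obtain m where m: "j - i = Suc m" using ij(2) by (metis Suc_diff_Suc)
  obtain h where "\<And>x. (?f ^^ m) x = qpoly h x" using comp by blast
  moreover have "?f ((?f ^^ m) x) = x" "(?f ^^ m) (?f x) = x" for x
    using id[of x] unfolding m by (simp_all add: funpow_swap1)
  ultimately show ?thesis using that by metis
qed

section \<open>Coefficients from power sums\<close>

lemma power_q_le:
  assumes "i < n"
  shows "2 * q ^ i \<le> q ^ n"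
proof -
  have "2 * q ^ i \<le> q * q ^ i" using q_ge_2 by (rule mult_le_mono1)
  also have "\<dots> = q ^ Suc i" by simp
  also have "\<dots> \<le> q ^ n" using assms q_ge_2 by (intro power_increasing) auto
  finally show ?thesis .
qed

text \<open>Turns quotients into powers with natural exponents, to which
  \<open>sum_power_nonzero\<close> applies.\<close>

lemma divide_power_eq:
  assumes "(x::'a) \<noteq> 0" "m \<le> q ^ n - 1"
  shows "y / x ^ m = y * x ^ (q ^ n - 1 - m)"
proof -
  have "x ^ (q ^ n - 1 - m) * x ^ m = x ^ (q ^ n - 1)"
    using assms(2) by (simp del: diff_diff_left flip: power_add)
  also have "\<dots> = 1" using power_card_minus_1_eq_1[OF assms(1)] card by simp
  finally show ?thesis using assms(1) by (simp add: field_simps)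
qed

text \<open>After division by \<open>x ^ (q ^ k)\<close> the exponent is a multiple of
  \<open>q ^ n - 1\<close> for the term of index \<open>k\<close> alone. The case
  \<open>k = 0\<close> is the first power sum of the slopes.\<close>

lemma sum_qpoly_coeff:
  assumes "k < n"
  shows "(\<Sum>x\<in>-{0}. qpoly a x / x ^ (q ^ k)) = - a k"
proof -
  let ?M = "q ^ n - 1"
  have le: "q ^ k \<le> ?M" using power_q_le[OF assms] zero_less_power[of q k] q_ge_2 by linarith
  have iff: "?M dvd q ^ i + (?M - q ^ k) \<longleftrightarrow> i = k" if "i < n" for i
  proof -
    have "0 < q ^ i" "0 < q ^ k" using q_ge_2 by auto
    hence "?M dvd q ^ i + (?M - q ^ k) \<longleftrightarrow> q ^ i = q ^ k"
      using power_q_le[OF that] power_q_le[OF assms] by (intro dvd_add_diff_iff_eq) linarith+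
    thus ?thesis using q_ge_2 by (simp add: power_inject_exp)
  qed
  have "(\<Sum>x\<in>-{0}. qpoly a x / x ^ (q ^ k)) =
        (\<Sum>x\<in>-{0}. \<Sum>i<n. a i * x ^ (q ^ i + (?M - q ^ k)))"
  proof (rule sum.cong)
    fix x :: 'a assume "x \<in> -{0}"
    hence "qpoly a x / x ^ (q ^ k) = qpoly a x * x ^ (?M - q ^ k)"
      using le by (intro divide_power_eq) auto
    thus "qpoly a x / x ^ (q ^ k) = (\<Sum>i<n. a i * x ^ (q ^ i + (?M - q ^ k)))"
      by (simp add: qpoly_def sum_distrib_right power_add mult.assoc)
  qed simp
  also have "\<dots> = (\<Sum>i<n. a i * (\<Sum>x\<in>-{0}. x ^ (q ^ i + (?M - q ^ k))))"
    by (subst sum.swap) (simp add: sum_distrib_left)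
  also have "\<dots> = (\<Sum>i<n. if i = k then - a i else 0)"
  proof (intro sum.cong refl)
    fix i assume "i \<in> {..<n}"
    hence "(\<Sum>x\<in>-{0::'a}. x ^ (q ^ i + (?M - q ^ k))) = (if i = k then -1 else 0)"
      unfolding sum_power_nonzero card using iff[of i] by simp
    thus "a i * (\<Sum>x\<in>-{0}. x ^ (q ^ i + (?M - q ^ k))) = (if i = k then - a i else 0)"
      by (simp only:) auto
  qed
  finally show ?thesis using assms by simp
qed

lemma qpoly_coeff_unique:
  assumes "\<And>x. qpoly a x = qpoly b x" "k < n"
  shows "a k = b k"
  using sum_qpoly_coeff[OF assms(2), of a] sum_qpoly_coeff[OF assms(2), of b] assms(1) by simp

text \<open>Expanding the product of \<open>qpoly a x\<close> and its Frobenius power, the exponent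
  \<open>q ^ i + q ^ j - 1 - q ^ k\<close> is a multiple of \<open>q ^ n - 1\<close> exactly when
  \<open>i\<close> and \<open>j\<close> are 0 and \<open>k\<close> in some order.\<close>

lemma sum_qpoly_slopes:
  assumes "1 \<le> k" "k < n"
  shows "(\<Sum>x\<in>-{0}. (qpoly a x / x) ^ (1 + q ^ k)) =
         - (a 0 ^ (1 + q ^ k) + a k * a (n - k) ^ (q ^ k))"
proof -
  let ?M = "q ^ n - 1"
  \<comment> \<open>The coefficients of \<open>qpoly a x ^ (q ^ k)\<close>; in particular
    \<open>b k = a 0 ^ (q ^ k)\<close> and \<open>b 0 = a (n - k) ^ (q ^ k)\<close>.\<close>
  define b where "b = (\<lambda>i. a ((i + (n - k)) mod n) ^ (q ^ k))"
  have qk: "2 * q ^ k \<le> q ^ n" by (rule power_q_le[OF assms(2)])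
  have pos: "0 < q ^ i" for i using q_ge_2 by auto
  have "q ^ 1 \<le> q ^ k" using assms(1) q_ge_2 by (intro power_increasing) auto
  hence q2: "2 \<le> q ^ k" using q_ge_2 by simp
  have le: "1 + q ^ k \<le> ?M" using qk q2 by linarith
  have iff: "?M dvd (q ^ i + q ^ j) + (?M - (1 + q ^ k)) \<longleftrightarrow> (i = 0 \<and> j = k) \<or> (i = k \<and> j = 0)"
    if "i < n" "j < n" for i j
  proof -
    have "?M dvd (q ^ i + q ^ j) + (?M - (1 + q ^ k)) \<longleftrightarrow> q ^ i + q ^ j = 1 + q ^ k"
      \<comment> \<open>The factor 2 in \<open>power_q_le\<close> keeps the sum
        \<open>q ^ i + q ^ j\<close> at most \<open>q ^ n\<close>.\<close>
      using power_q_le[OF that(1)] power_q_le[OF that(2)] qk le q2 pos[of i] pos[of j]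
      by (intro dvd_add_diff_iff_eq) linarith+
    also have "\<dots> \<longleftrightarrow> (i = 0 \<and> j = k) \<or> (i = k \<and> j = 0)"
      using sum_two_powers_eq[OF q_ge_2 assms(1)] by auto
    finally show ?thesis .
  qed
  have "(\<Sum>x\<in>-{0}. (qpoly a x / x) ^ (1 + q ^ k)) =
        (\<Sum>x\<in>-{0}. \<Sum>i<n. \<Sum>j<n. a i * b j * x ^ ((q ^ i + q ^ j) + (?M - (1 + q ^ k))))"
  proof (rule sum.cong)
    fix x :: 'a assume "x \<in> -{0}"
    hence x: "x \<noteq> 0" by simp
    have "(qpoly a x / x) ^ (1 + q ^ k) = qpoly a x * qpoly a x ^ (q ^ k) / x ^ (1 + q ^ k)"
      by (simp add: power_divide)
    also have "\<dots> = qpoly a x * qpoly b x * x ^ (?M - (1 + q ^ k))"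
      unfolding divide_power_eq[OF x le] using assms(2) by (simp add: qpoly_frob b_def)
    also have "\<dots> = (\<Sum>i<n. \<Sum>j<n. a i * b j * x ^ ((q ^ i + q ^ j) + (?M - (1 + q ^ k))))"
      unfolding qpoly_def sum_product unfolding sum_distrib_right
      by (intro sum.cong refl) (simp add: power_add)
    finally show "(qpoly a x / x) ^ (1 + q ^ k) = \<dots>" .
  qed simp
  also have "\<dots> = (\<Sum>i<n. \<Sum>j<n. a i * b j * (\<Sum>x\<in>-{0}. x ^ ((q ^ i + q ^ j) + (?M - (1 + q ^ k)))))"
    by (subst sum.swap, rule sum.cong, simp, subst sum.swap) (simp add: sum_distrib_left)
  also have "\<dots> = (\<Sum>i<n. \<Sum>j<n. (if i = 0 \<and> j = k then - (a 0 * b k) else 0) +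
                                 (if i = k \<and> j = 0 then - (a k * b 0) else 0))"
  proof (intro sum.cong refl)
    fix i j assume "i \<in> {..<n}" "j \<in> {..<n}"
    hence "(\<Sum>x\<in>-{0::'a}. x ^ ((q ^ i + q ^ j) + (?M - (1 + q ^ k)))) =
        (if (i = 0 \<and> j = k) \<or> (i = k \<and> j = 0) then -1 else 0)"
      unfolding sum_power_nonzero card using iff[of i j] by simp
    thus "a i * b j * (\<Sum>x\<in>-{0}. x ^ ((q ^ i + q ^ j) + (?M - (1 + q ^ k)))) =
        (if i = 0 \<and> j = k then - (a 0 * b k) else 0) +
        (if i = k \<and> j = 0 then - (a k * b 0) else 0)"
      using assms(1) by (simp only:) auto
  qed
  also have "\<dots> = - (a 0 * b k) - a k * b 0"
  proof -
    have "(\<Sum>i<n. \<Sum>j<n. if i = i0 \<and> j = j0 then c else 0) = c" if "i0 < n" "j0 < n"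
      for i0 j0 and c :: 'a
    proof -
      have "(\<Sum>i<n. \<Sum>j<n. if i = i0 \<and> j = j0 then c else 0) =
            (\<Sum>i<n. if i = i0 then (\<Sum>j<n. if j = j0 then c else 0) else 0)"
        by (rule sum.cong) auto
      thus ?thesis using that by simp
    qed
    thus ?thesis using assms(2) n_pos by (simp add: sum.distrib)
  qed
  also have "\<dots> = - (a 0 ^ (1 + q ^ k) + a k * a (n - k) ^ (q ^ k))"
    using assms by (simp add: b_def)
  finally show ?thesis .
qed

text \<open>Exponent 1 gives \<open>a 0 = b 0\<close>, so the contribution of index 0 cancels from
  the sums with exponent \<open>1 + q ^ k\<close>.\<close>

lemma slopes_qpoly_eq:
  assumes "slopes (qpoly a) = slopes (qpoly b)" "1 \<le> k" "k < n"
  shows "a k * a (n - k) ^ (q ^ k) = b k * b (n - k) ^ (q ^ k)"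
proof -
  have *: "(\<Sum>x\<in>-{0}. (qpoly a x / x) ^ d) = (\<Sum>x\<in>-{0}. (qpoly b x / x) ^ d)" for d
    using assms(1) by (simp add: sum_slopes additive_qpoly)
  have "a 0 = b 0"
    using *[of 1] sum_qpoly_coeff[of 0 a] sum_qpoly_coeff[of 0 b] n_pos by simp
  thus ?thesis
    using *[of "1 + q ^ k"] unfolding sum_qpoly_slopes[OF assms(2,3)] by simp
qed

text \<open>The inverse of the matrix with rows \<open>(A, B)\<close> and \<open>(C, D)\<close> maps \<open>(y, g y)\<close>, up to a scalar, to
  \<open>(D y - B g y, A g y - C y)\<close>.\<close>

lemma slopes_projectivity_cases:
  assumes inj: "\<And>y. y \<noteq> 0 \<Longrightarrow> D * y - B * qpoly b y \<noteq> 0" and det: "A * D - B * C \<noteq> 0"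
    and S: "S = {(A * qpoly b y - C * y) / (D * y - B * qpoly b y) | y. y \<noteq> 0}"
  obtains (affine) c d e where "S = slopes (\<lambda>x. c * x + e * qpoly b (d * x))"
  | (inverse) r \<alpha> \<beta> where "B \<noteq> 0" "\<beta> \<noteq> 0" "S = slopes (\<lambda>x. \<alpha> * x + \<beta> * qpoly r x)"
      "\<And>x. D * qpoly r x - B * qpoly b (qpoly r x) = x"
proof (cases "B = 0")
  case True
  hence D: "D \<noteq> 0" using det by auto
  \<comment> \<open>Substitute \<open>x = D * y\<close>.\<close>
  have "S = slopes (\<lambda>x. - C / D * x + A * qpoly b (inverse D * x))" (is "_ = slopes ?h")
  proof -
    have "(A * qpoly b y - C * y) / (D * y - B * qpoly b y) = ?h (D * y) / (D * y)" for y
      using D True by (cases "y = 0") (simp_all add: mult.assoc[symmetric] diff_divide_distrib)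
    hence "S = {?h (D * y) / (D * y) | y. y \<noteq> 0}" unfolding S by simp
    also have "\<dots> = slopes ?h"
    proof (rule slopes_reindex[symmetric])
      show "surj ((*) D)" using D by (intro surjI[of _ "\<lambda>x. x / D"]) simp
    qed (use D in simp)
    finally show ?thesis .
  qed
  thus ?thesis by (rule affine)
next
  case False
  define P where "P = (\<lambda>i. (if i = 0 then D else 0) - B * b i)"
  have P: "qpoly P y = D * y - B * qpoly b y" for y
    unfolding P_def by (simp only: qpoly_linear[of D y] qpoly_scale qpoly_diff)
  interpret P: Modules.additive "qpoly P" by (rule additive_qpoly)
  have "inj (qpoly P)"
  proof (rule injI)
    fix x y assume "qpoly P x = qpoly P y"
    hence "qpoly P (x - y) = 0" by (simp add: P.diff)
    thus "x = y" using inj[of "x - y"] by (auto simp: P)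
  qed
  then obtain r where r: "\<And>x. qpoly P (qpoly r x) = x" "\<And>x. qpoly r (qpoly P x) = x"
    using qpoly_inverse by blast
  \<comment> \<open>With \<open>x = P y\<close> one has \<open>g y = (D * y - x) / B\<close> and
    \<open>y = r x\<close>; inserting both into \<open>A * g y - C * y\<close> gives these
    constants.\<close>
  let ?\<alpha> = "- A / B" and ?\<beta> = "(A * D - B * C) / B"
  let ?h = "\<lambda>x. ?\<alpha> * x + ?\<beta> * qpoly r x"
  have slope: "(A * qpoly b y - C * y) / (D * y - B * qpoly b y) = ?h (qpoly P y) / qpoly P y" for y
  proof -
    have "?h (qpoly P y) = A * qpoly b y - C * y"
      unfolding r(2) unfolding P using False by (simp add: field_simps)
    thus ?thesis by (simp add: P)
  qed
  have ne: "qpoly P y \<noteq> 0 \<longleftrightarrow> y \<noteq> 0" for y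
    using inj[of y] P.zero by (auto simp: P)
  have "S = {?h (qpoly P y) / qpoly P y | y. y \<noteq> 0}"
    unfolding S slope ..
  also have "\<dots> = slopes ?h"
    by (rule slopes_reindex[symmetric]) (use ne surjI[of "qpoly P", OF r(1)] in auto)
  finally have "S = slopes ?h" .
  thus ?thesis
    using False det r(1) by (intro inverse[of ?\<beta> ?\<alpha> r]) (auto simp: P)
qed

section \<open>Zero patterns of coefficients and the two inequivalences\<close>

lemma binomial_qpoly:
  assumes "s < n" "t < n" "s \<noteq> t"
  shows "(\<lambda>x. c * x ^ (q ^ s) + x ^ (q ^ t)) = qpoly (\<lambda>i. if i = s then c else if i = t then 1 else 0)"
proof
  fix x
  have "c * x ^ (q ^ s) + 1 * x ^ (q ^ t) =
      qpoly (\<lambda>i. (if i = s then c else 0) + (if i = t then 1 else 0)) x"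
    using assms(1,2) by (simp only: qpoly_monom qpoly_add)
  also have "(\<lambda>i. (if i = s then c else 0) + (if i = t then 1 else 0)) =
      (\<lambda>i. if i = s then c else if i = t then 1 else 0)"
    using assms(3) by auto
  finally show "c * x ^ (q ^ s) + x ^ (q ^ t) =
      qpoly (\<lambda>i. if i = s then c else if i = t then 1 else 0) x" by simp
qed

text \<open>The term with \<alpha> affects index 0 alone, while \<open>k\<close> and
  \<open>n - k\<close> are positive; elsewhere the coefficients are nonzero multiples of those of
  \<open>r\<close>.\<close>

lemma slopes_inverse_coeffs:
  assumes "slopes (qpoly a) = slopes (\<lambda>x. \<alpha> * x + \<beta> * qpoly r x)" "\<beta> \<noteq> 0"
    "1 \<le> k" "k < n"
  shows "a k * a (n - k) ^ (q ^ k) = 0 \<longleftrightarrow> r k = 0 \<or> r (n - k) = 0"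
proof -
  let ?h = "\<lambda>i. (if i = 0 then \<alpha> else 0) + \<beta> * r i"
  have "(\<lambda>x. \<alpha> * x + \<beta> * qpoly r x) = qpoly ?h"
    by (intro ext) (simp only: qpoly_linear[of \<alpha>] qpoly_scale qpoly_add)
  hence "a k * a (n - k) ^ (q ^ k) = ?h k * ?h (n - k) ^ (q ^ k)"
    using slopes_qpoly_eq[of a ?h k] assms by simp
  thus ?thesis using assms q_ge_2 by auto
qed

text \<open>In the affine case there is a single coefficient of positive index, too few for a
  nonzero product at \<open>s\<close> and \<open>n - s\<close>. In the inverse case the recurrence
  forces all \<open>r i\<close> to vanish together, or leaves at most \<open>r (n - 1)\<close>
  nonzero.\<close>

lemma slopes_neq_pseudoregulus:
  fixes \<delta> A B C D :: 'a
  assumes n: "n \<ge> 4" and s: "1 \<le> s" "s < n" "coprime s n" and "\<delta> \<noteq> 0"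
    and det: "A * D - B * C \<noteq> 0" and inj: "\<And>y. y \<noteq> 0 \<Longrightarrow> D * y - B * y ^ q \<noteq> 0"
  shows "slopes (\<lambda>x. \<delta> * x ^ (q ^ s) + x ^ (q ^ (n - s))) \<noteq>
    {(A * y ^ q - C * y) / (D * y - B * y ^ q) | y. y \<noteq> 0}"
proof
  \<comment> \<open>Equality would make \<open>s\<close> a divisor of \<open>n\<close>, hence
    \<open>s = 1\<close> and \<open>n = 2\<close>.\<close>
  have sn: "s \<noteq> n - s"
  proof
    assume "s = n - s"
    hence "n = s * 2" by simp
    with s(3) have "s = 1" by simp
    thus False using \<open>n = s * 2\<close> n by simp
  qed
  define a where "a = (\<lambda>i. if i = s then \<delta> else if i = n - s then 1 else 0)"
  define b :: "nat \<Rightarrow> 'a" where "b = (\<lambda>i. if i = 1 then 1 else 0)"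
  have b: "qpoly b x = x ^ q" for x
    using qpoly_monom[of 1 1 x] n by (simp add: b_def)
  have a: "(\<lambda>x. \<delta> * x ^ (q ^ s) + x ^ (q ^ (n - s))) = qpoly a"
    unfolding a_def using s sn by (intro binomial_qpoly) auto
  have as: "a s * a (n - s) ^ (q ^ s) \<noteq> 0"
    using \<open>\<delta> \<noteq> 0\<close> sn by (simp add: a_def)
  assume "slopes (\<lambda>x. \<delta> * x ^ (q ^ s) + x ^ (q ^ (n - s))) =
    {(A * y ^ q - C * y) / (D * y - B * y ^ q) | y. y \<noteq> 0}"
  hence S: "slopes (qpoly a) = {(A * qpoly b y - C * y) / (D * y - B * qpoly b y) | y. y \<noteq> 0}"
    unfolding a b .
  have inj': "\<And>y. y \<noteq> 0 \<Longrightarrow> D * y - B * qpoly b y \<noteq> 0" using inj by (simp add: b)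
  show False
  proof (rule slopes_projectivity_cases[OF inj' det S])
    fix c d e assume affine: "slopes (qpoly a) = slopes (\<lambda>x. c * x + e * qpoly b (d * x))"
    let ?h = "\<lambda>i. (if i = 0 then c else 0) + (if i = 1 then e * d ^ q else 0)"
    have "c * x + e * qpoly b (d * x) = qpoly ?h x" for x
    proof -
      have "c * x + e * qpoly b (d * x) = c * x + (e * d ^ q) * x ^ (q ^ 1)"
        by (simp add: b power_mult_distrib)
      also have "\<dots> = qpoly ?h x"
        using n by (subst qpoly_monom) (simp_all only: qpoly_linear[of c] qpoly_add)
      finally show ?thesis .
    qed
    hence "slopes (qpoly a) = slopes (qpoly ?h)" using affine by simp
    hence "a s * a (n - s) ^ (q ^ s) = ?h s * ?h (n - s) ^ (q ^ s)"
      using s n by (intro slopes_qpoly_eq) auto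
    moreover have "s \<noteq> 1 \<or> n - s \<noteq> 1" using n by linarith
    ultimately show False using as s q_ge_2 by (auto split: if_splits)
  next
    fix r \<alpha> \<beta>
    assume inverse: "B \<noteq> 0" "\<beta> \<noteq> 0" "slopes (qpoly a) = slopes (\<lambda>x. \<alpha> * x + \<beta> * qpoly r x)"
      "\<And>x. D * qpoly r x - B * qpoly b (qpoly r x) = x"
    have coeffs: "a k * a (n - k) ^ (q ^ k) = 0 \<longleftrightarrow> r k = 0 \<or> r (n - k) = 0"
      if "1 \<le> k" "k < n" for k
      using slopes_inverse_coeffs[OF inverse(3,2)] n that by simp
    \<comment> \<open>Coefficients of the identity between \<open>P\<close> composed with
      \<open>r\<close> and the identity map; the index \<open>(i + (n - 1)) mod n\<close> is the
      cyclic predecessor of \<open>i\<close>.\<close>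
    have rec: "D * r i - B * r ((i + (n - 1)) mod n) ^ q = (if i = 0 then 1 else 0)"
      if "i < n" for i
    proof (rule qpoly_coeff_unique[OF _ that])
      fix x
      have "qpoly (\<lambda>i. D * r i - B * r ((i + (n - 1)) mod n) ^ q) x =
          D * qpoly r x - B * qpoly r x ^ (q ^ 1)"
        using n by (subst qpoly_frob) (simp_all add: qpoly_scale qpoly_diff)
      also have "\<dots> = 1 * x" using inverse(4)[of x] by (simp add: b)
      finally show "qpoly (\<lambda>i. D * r i - B * r ((i + (n - 1)) mod n) ^ q) x =
          qpoly (\<lambda>i. if i = 0 then 1 else 0) x"
        by (simp only: qpoly_linear)
    qed
    have rec_Suc: "D * r (Suc i) = B * r i ^ q" if "Suc i < n" for i
      using rec[OF that] that by (simp add: mod_if)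
    show False
    proof (cases "D = 0")
      case True
      hence "r i = 0" if "Suc i < n" for i
        using rec_Suc[OF that] inverse(1) by simp
      \<comment> \<open>One of \<open>s\<close> and \<open>n - s\<close> is therefore an index at
        which \<open>r\<close> vanishes.\<close>
      moreover have "Suc s < n \<or> Suc (n - s) < n" using s n by linarith
      ultimately show False using coeffs[of s] s as by auto
    next
      case False
      have zero_iff: "r i = 0 \<longleftrightarrow> r 0 = 0" if "i < n" for i
        using that
      proof (induction i)
        case (Suc i)
        have "r (Suc i) = 0 \<longleftrightarrow> r i = 0"
          using rec_Suc[OF Suc.prems] False inverse(1) q_ge_2
          by (metis mult_eq_0_iff power_eq_0_iff not_numeral_le_zero neq0_conv)
        thus ?case using Suc by simp
      qed simp
      \<comment> \<open>Three candidates, two excluded values: at such a \<open>k\<close> the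
        product for \<open>a\<close> is zero, which forces a zero of \<open>r\<close>.\<close>
      obtain k where k: "k \<in> {1, 2, 3}" "k \<noteq> s" "k \<noteq> n - s"
      proof -
        have "\<exists>k. k \<in> {1, 2, 3} \<and> k \<noteq> s \<and> k \<noteq> t" for t :: nat
          by simp arith
        thus ?thesis using that by blast
      qed
      hence "a k * a (n - k) ^ (q ^ k) = 0" by (simp add: a_def)
      hence "r k = 0 \<or> r (n - k) = 0" using coeffs[of k] k n by auto
      hence "r 0 = 0" using zero_iff[of k] zero_iff[of "n - k"] k n by auto
      moreover from this have "r (n - 1) = 0" using zero_iff[of "n - 1"] n by simp
      \<comment> \<open>All \<open>r i\<close> vanish, but the recurrence at index 0 has right side
        1.\<close>
      ultimately show False using rec[of 0] n q_ge_2 by (simp add: power_0_left)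
    qed
  qed
qed

text \<open>The left polynomial has indices 1 and 7, while \<open>g\<close> has 3 and 5, so the
  affine case fails at \<open>k = 1\<close>. In the inverse case the recurrence links
  \<open>r i\<close> to \<open>r (i - 3)\<close> and \<open>r (i - 5)\<close> modulo 8, against the
  zeros that the left side imposes on \<open>r\<close>.\<close>

lemma slopes_degree_8_neq:
  fixes \<delta> \<rho> A B C D :: 'a
  assumes n: "n = 8" and "\<delta> \<noteq> 0" "\<rho> \<noteq> 0" and det: "A * D - B * C \<noteq> 0"
    and g: "\<And>x. g x = \<rho> * x ^ (q ^ 3) + x ^ (q ^ 5)"
    and inj: "\<And>y. y \<noteq> 0 \<Longrightarrow> D * y - B * g y \<noteq> 0"
  shows "slopes (\<lambda>x. \<delta> * x ^ (q ^ 1) + x ^ (q ^ 7)) \<noteq>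
    {(A * g y - C * y) / (D * y - B * g y) | y. y \<noteq> 0}"
proof
  define a :: "nat \<Rightarrow> 'a" where "a = (\<lambda>i. if i = 1 then \<delta> else if i = 7 then 1 else 0)"
  define b :: "nat \<Rightarrow> 'a" where "b = (\<lambda>i. if i = 3 then \<rho> else if i = 5 then 1 else 0)"
  have b: "g = qpoly b"
    unfolding b_def using n by (subst binomial_qpoly[symmetric]) (auto simp: g)
  have a: "(\<lambda>x. \<delta> * x ^ (q ^ 1) + x ^ (q ^ 7)) = qpoly a"
    unfolding a_def using n by (intro binomial_qpoly) auto
  assume "slopes (\<lambda>x. \<delta> * x ^ (q ^ 1) + x ^ (q ^ 7)) =
    {(A * g y - C * y) / (D * y - B * g y) | y. y \<noteq> 0}"
  hence S: "slopes (qpoly a) = {(A * qpoly b y - C * y) / (D * y - B * qpoly b y) | y. y \<noteq> 0}"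
    unfolding a b .
  have inj': "\<And>y. y \<noteq> 0 \<Longrightarrow> D * y - B * qpoly b y \<noteq> 0" using inj by (simp add: b)
  show False
  proof (rule slopes_projectivity_cases[OF inj' det S])
    fix c d e assume affine: "slopes (qpoly a) = slopes (\<lambda>x. c * x + e * qpoly b (d * x))"
    let ?h = "\<lambda>i::nat. (if i = 0 then c else 0) + ((if i = 3 then e * \<rho> * d ^ (q ^ 3) else 0) +
      (if i = 5 then e * d ^ (q ^ 5) else 0))"
    have "c * x + e * qpoly b (d * x) = qpoly ?h x" for x
    proof -
      have "c * x + e * qpoly b (d * x) =
          c * x + ((e * \<rho> * d ^ (q ^ 3)) * x ^ (q ^ 3) + (e * d ^ (q ^ 5)) * x ^ (q ^ 5))"
        by (simp add: b[symmetric] g power_mult_distrib algebra_simps)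
      also have "\<dots> = qpoly ?h x"
      proof -
        have "3 < n" "5 < n" using n by simp_all
        thus ?thesis
          by (simp only: qpoly_linear[of c x] qpoly_monom[of 3 "e * \<rho> * d ^ (q ^ 3)" x]
              qpoly_monom[of 5 "e * d ^ (q ^ 5)" x] qpoly_add)
      qed
      finally show ?thesis .
    qed
    hence "slopes (qpoly a) = slopes (qpoly ?h)" using affine by simp
    hence "a 1 * a (n - 1) ^ (q ^ 1) = ?h 1 * ?h (n - 1) ^ (q ^ 1)"
      using n by (intro slopes_qpoly_eq) auto
    thus False using \<open>\<delta> \<noteq> 0\<close> by (simp add: n a_def)
  next
    fix r \<alpha> \<beta>
    assume inverse: "B \<noteq> 0" "\<beta> \<noteq> 0" "slopes (qpoly a) = slopes (\<lambda>x. \<alpha> * x + \<beta> * qpoly r x)"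
      "\<And>x. D * qpoly r x - B * qpoly b (qpoly r x) = x"
    have coeffs: "a k * a (8 - k) ^ (q ^ k) = 0 \<longleftrightarrow> r k = 0 \<or> r (8 - k) = 0"
      if "1 \<le> k" "k < 8" for k
      using slopes_inverse_coeffs[OF inverse(3,2)] n that by simp
    have q0: "q \<noteq> 0" using q_ge_2 by simp
    have r17: "r 1 \<noteq> 0" "r 7 \<noteq> 0"
      using coeffs[of 1] \<open>\<delta> \<noteq> 0\<close> by (simp_all add: a_def)
    have r26: "r 2 = 0 \<or> r 6 = 0" using coeffs[of 2] by (simp add: a_def)
    have r35: "r 3 = 0 \<or> r 5 = 0" using coeffs[of 3] by (simp add: a_def)
    have r4: "r 4 = 0" using coeffs[of 4] by (simp add: a_def)
    have rec: "D * r i - B * (\<rho> * r ((i + 5) mod 8) ^ (q ^ 3) + r ((i + 3) mod 8) ^ (q ^ 5)) =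
        (if i = 0 then 1 else 0)" if "i < n" for i
    proof (rule qpoly_coeff_unique[OF _ that])
      fix x
      have "qpoly (\<lambda>i. D * r i - B * (\<rho> * r ((i + 5) mod 8) ^ (q ^ 3) + r ((i + 3) mod 8) ^ (q ^ 5))) x =
          D * qpoly r x - B * (\<rho> * qpoly r x ^ (q ^ 3) + qpoly r x ^ (q ^ 5))"
      proof -
        have "qpoly r x ^ (q ^ 3) = qpoly (\<lambda>i. r ((i + 5) mod 8) ^ (q ^ 3)) x"
          "qpoly r x ^ (q ^ 5) = qpoly (\<lambda>i. r ((i + 3) mod 8) ^ (q ^ 5)) x"
          using qpoly_frob[of 3 r x] qpoly_frob[of 5 r x] n by simp_all
        thus ?thesis by (simp only: qpoly_scale qpoly_diff qpoly_add)
      qed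
      also have "\<dots> = 1 * x" using inverse(4)[of x] by (simp add: b[symmetric] g)
      finally show "qpoly (\<lambda>i. D * r i - B * (\<rho> * r ((i + 5) mod 8) ^ (q ^ 3) + r ((i + 3) mod 8) ^ (q ^ 5))) x =
          qpoly (\<lambda>i. if i = 0 then 1 else 0) x"
        by (simp only: qpoly_linear)
    qed
    show False
    proof (cases "D = 0")
      case True
      \<comment> \<open>For \<open>D = 0\<close>, indices 6 and 2 tie \<open>r 3\<close> to
        \<open>r 1\<close> and \<open>r 5\<close> to \<open>r 7\<close>, making both members of the
        pair 3, 5 nonzero.\<close>
      have "\<rho> * r 3 ^ (q ^ 3) + r 1 ^ (q ^ 5) = 0" "\<rho> * r 7 ^ (q ^ 3) + r 5 ^ (q ^ 5) = 0"
        using rec[of 6] rec[of 2] True inverse(1) n by simp_all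
      hence "r 3 \<noteq> 0" "r 5 \<noteq> 0" using r17 \<open>\<rho> \<noteq> 0\<close> q0 by auto
      thus False using r35 by simp
    next
      case False
      \<comment> \<open>Since \<open>r 4 = 0\<close>, indices 1 and 7 tie \<open>r 1\<close> to
        \<open>r 6\<close> and \<open>r 7\<close> to \<open>r 2\<close>, making both members of the
        pair 2, 6 nonzero.\<close>
      have "D * r 1 = B * (\<rho> * r 6 ^ (q ^ 3))" "D * r 7 = B * r 2 ^ (q ^ 5)"
        using rec[of 1] rec[of 7] r4 n q0 by simp_all
      hence "r 6 \<noteq> 0" "r 2 \<noteq> 0" using False r17 q0 by auto
      thus False using r26 by simp
    qed
  qed
qed

end

section \<open>Semilinear equivalence of linear sets\<close>

lemma field_automorphism_simps:
  assumes "field_automorphism \<sigma>"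
  shows "\<sigma> (x + y) = \<sigma> x + \<sigma> y" "\<sigma> (x * y) = \<sigma> x * \<sigma> y" "\<sigma> 0 = 0" "\<sigma> 1 = 1"
    "\<sigma> x = 0 \<longleftrightarrow> x = 0" "\<sigma> (x ^ k) = \<sigma> x ^ k"
proof -
  have s: "bij \<sigma>" "\<And>x y. \<sigma> (x + y) = \<sigma> x + \<sigma> y" "\<And>x y. \<sigma> (x * y) = \<sigma> x * \<sigma> y"
    using assms by (auto simp: field_automorphism_def)
  show "\<sigma> (x + y) = \<sigma> x + \<sigma> y" "\<sigma> (x * y) = \<sigma> x * \<sigma> y" by (fact s)+
  show 0: "\<sigma> 0 = 0" using s(2)[of 0 0] by (metis add.right_neutral add_left_cancel)
  have inj: "\<sigma> x = \<sigma> y \<longleftrightarrow> x = y" for x y using s(1) by (auto simp: bij_def inj_def)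
  show "\<sigma> x = 0 \<longleftrightarrow> x = 0" using inj[of x 0] 0 by simp
  have "\<sigma> 1 \<noteq> 0" using inj[of 1 0] 0 by simp
  thus 1: "\<sigma> 1 = 1" using s(3)[of 1 1] by simp
  show "\<sigma> (x ^ k) = \<sigma> x ^ k" by (induction k) (simp_all add: 1 s(3))
qed

lemma vector_2_eq_axes:
  "vector [x, y] = x *s vector [1, 0] + y *s (vector [0, 1] :: 'a::field ^ 2)"
  by (simp add: vec_eq_iff forall_2)

lemma vector_2_eq_0_iff: "vector [x, y] = (0 :: 'a::zero ^ 2) \<longleftrightarrow> x = 0 \<and> y = 0"
  by (simp add: vec_eq_iff forall_2)

text \<open>A semilinear map is a matrix applied after \<sigma>. It sends \<open>(x, f x)\<close> to
  a multiple of some \<open>(y, g y)\<close>; inverting the matrix and dividing the coordinates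
  eliminates the scalar.\<close>

lemma PGammaL2_equivalent_slopes:
  fixes f g :: "'a::{field,finite} \<Rightarrow> 'a"
  assumes equiv: "PGammaL2_equivalent (linear_set {vector [x, f x] | x. True})
      (linear_set {vector [x, g x] | x. True})"
    and f0: "f 0 = 0" and g0: "g 0 = 0"
  obtains \<sigma> A B C D where "field_automorphism \<sigma>" "A * D - B * C \<noteq> 0"
    "\<forall>y. y \<noteq> 0 \<longrightarrow> D * y - B * g y \<noteq> 0"
    "{\<sigma> (f x) / \<sigma> x | x. x \<noteq> 0} = {(A * g y - C * y) / (D * y - B * g y) | y. y \<noteq> 0}"
proof -
  have lin: "linear_set {vector [x, h x] | x. True} = {vec.span {vector [x, h x] :: 'a ^ 2} | x. x \<noteq> 0}"
    if "h 0 = 0" for h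
  proof -
    have *: "{vector [x, h x] | x. True} - {0 :: 'a ^ 2} = {vector [x, h x] | x. x \<noteq> 0}"
      using that by (auto simp: vector_2_eq_0_iff)
    show ?thesis unfolding linear_set_def * by auto
  qed
  obtain \<phi> where "\<phi> \<in> PGammaL2" and \<phi>: "\<phi> ` {vec.span {vector [x, f x] :: 'a ^ 2} | x. x \<noteq> 0} =
      {vec.span {vector [x, g x]} | x. x \<noteq> 0}"
    using equiv unfolding PGammaL2_equivalent_def lin[of f, OF f0] lin[of g, OF g0] by (rule bexE)
  from this(1) obtain F where F: "F \<in> GammaL2" and "\<phi> = restrict (\<lambda>P. F ` P) PG1"
    unfolding PGammaL2_def by blast
  with \<phi> have img: "restrict (\<lambda>P. F ` P) PG1 ` {vec.span {vector [x, f x] :: 'a ^ 2} | x. x \<noteq> 0} =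
      {vec.span {vector [x, g x]} | x. x \<noteq> 0}"
    by (simp only:)
  have "{vec.span {vector [x, f x] :: 'a ^ 2} | x. x \<noteq> 0} \<subseteq> PG1"
  proof clarify
    fix x :: 'a assume "x \<noteq> 0"
    hence "vector [x, f x] \<noteq> (0 :: 'a ^ 2)" by (simp add: vector_2_eq_0_iff)
    thus "vec.span {vector [x, f x] :: 'a ^ 2} \<in> PG1"
      unfolding PG1_def by (intro CollectI exI[of _ "vector [x, f x]"]) simp
  qed
  hence img: "(\<lambda>P. F ` P) ` {vec.span {vector [x, f x] :: 'a ^ 2} | x. x \<noteq> 0} =
      {vec.span {vector [x, g x]} | x. x \<noteq> 0}"
    using img by (subst image_cong[OF refl, of _ _ "restrict (\<lambda>P. F ` P) PG1"]) auto
  obtain \<sigma> where \<sigma>: "field_automorphism \<sigma>" and F_add: "\<And>u v. F (u + v) = F u + F v"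
    and F_scale: "\<And>c v. F (c *s v) = \<sigma> c *s F v" and F_bij: "bij F"
    using F by (auto simp: GammaL2_def)
  note \<sigma>_simps = field_automorphism_simps[OF \<sigma>]
  define A where "A = F (vector [1, 0]) $ 1"
  define B where "B = F (vector [0, 1]) $ 1"
  define C where "C = F (vector [1, 0]) $ 2"
  define D where "D = F (vector [0, 1]) $ 2"
  have F_eq: "F (vector [x, y]) = vector [A * \<sigma> x + B * \<sigma> y, C * \<sigma> x + D * \<sigma> y]" for x y
    by (subst vector_2_eq_axes) (simp add: F_add F_scale vec_eq_iff forall_2 A_def B_def C_def D_def mult.commute)
  have F_eq_0: "x = 0 \<and> y = 0" if "F (vector [x, y]) = 0" for x y
  proof -
    have "F (vector [x, y]) = F (vector [0, 0])"
      using that F_eq[of 0 0] by (simp add: \<sigma>_simps vector_2_eq_0_iff)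
    hence "vector [x, y] = (vector [0, 0] :: 'a ^ 2)" using F_bij by (metis bij_pointE)
    thus ?thesis by (simp add: vec_eq_iff forall_2)
  qed
  \<comment> \<open>Surjectivity of \<sigma> turns injectivity of \<open>F\<close> into injectivity
    of the matrix.\<close>
  have kernel: "z = 0 \<and> w = 0" if "A * z + B * w = 0" "C * z + D * w = 0" for z w
  proof -
    obtain x y where "z = \<sigma> x" "w = \<sigma> y"
      using \<sigma> unfolding field_automorphism_def by (metis bij_pointE)
    thus ?thesis using F_eq_0[of x y] that by (simp add: F_eq vector_2_eq_0_iff \<sigma>_simps)
  qed
  have det: "A * D - B * C \<noteq> 0"
  proof
    assume det: "A * D - B * C = 0"
    \<comment> \<open>If the determinant is zero, the columns of the adjugate lie in the kernel up
      to sign, so the whole matrix vanishes.\<close>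
    have "D = 0 \<and> - C = 0" using det by (intro kernel) (simp_all add: algebra_simps)
    moreover have "B = 0 \<and> - A = 0" using det by (intro kernel) (simp_all add: algebra_simps)
    ultimately show False using kernel[of 1 0] by simp
  qed
  have point: "\<exists>m. m \<noteq> 0 \<and> m * \<sigma> x = D * y - B * g y \<and> m * \<sigma> (f x) = A * g y - C * y"
    if "F ` vec.span {vector [x, f x]} = vec.span {vector [y, g y]}" "x \<noteq> 0" for x y
  proof -
    have "F (vector [x, f x]) \<in> vec.span {vector [y, g y]}"
      using that(1) by (auto intro: vec.span_base)
    then obtain c where c: "F (vector [x, f x]) = c *s vector [y, g y]"
      by (auto simp: vec.span_singleton)
    have "c \<noteq> 0" using c F_eq_0[of x "f x"] that(2) by auto
    have e1: "A * \<sigma> x + B * \<sigma> (f x) = c * y" and e2: "C * \<sigma> x + D * \<sigma> (f x) = c * g y"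
      using c by (simp_all add: F_eq vec_eq_iff forall_2)
    \<comment> \<open>Cramer's rule; the scalar \<open>m\<close> is the determinant divided by
      \<open>c\<close>.\<close>
    have "(A * D - B * C) * \<sigma> x = D * (A * \<sigma> x + B * \<sigma> (f x)) - B * (C * \<sigma> x + D * \<sigma> (f x))"
      by (simp add: algebra_simps)
    moreover have "(A * D - B * C) * \<sigma> (f x) =
        A * (C * \<sigma> x + D * \<sigma> (f x)) - C * (A * \<sigma> x + B * \<sigma> (f x))"
      by (simp add: algebra_simps)
    ultimately show ?thesis
      unfolding e1 e2 using \<open>c \<noteq> 0\<close> det
      by (intro exI[of _ "(A * D - B * C) / c"]) (simp add: field_simps)
  qed
  have image: "\<exists>y m. y \<noteq> 0 \<and> m \<noteq> 0 \<and> m * \<sigma> x = D * y - B * g y \<and> m * \<sigma> (f x) = A * g y - C * y"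
    if "x \<noteq> 0" for x
  proof -
    have "F ` vec.span {vector [x, f x]} \<in> {vec.span {vector [x, g x]} | x. x \<noteq> 0}"
      unfolding img[symmetric] using that by blast
    thus ?thesis using point[OF _ that] by blast
  qed
  have preimage: "\<exists>x m. x \<noteq> 0 \<and> m \<noteq> 0 \<and> m * \<sigma> x = D * y - B * g y \<and> m * \<sigma> (f x) = A * g y - C * y"
    if "y \<noteq> 0" for y
  proof -
    have "vec.span {vector [y, g y]} \<in> (\<lambda>P. F ` P) ` {vec.span {vector [x, f x] :: 'a ^ 2} | x. x \<noteq> 0}"
      unfolding img using that by blast
    then obtain x where "x \<noteq> 0" "F ` vec.span {vector [x, f x]} = vec.span {vector [y, g y]}"
      by auto
    thus ?thesis using point by blast
  qed
  have ratio: "\<sigma> (f x) / \<sigma> x = (A * g y - C * y) / (D * y - B * g y)"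
    if "m \<noteq> 0" "m * \<sigma> x = D * y - B * g y" "m * \<sigma> (f x) = A * g y - C * y" for x y m
    unfolding that(2,3)[symmetric] using that(1) by simp
  show ?thesis
  proof (rule that[OF \<sigma> det])
    \<comment> \<open>Every nonzero \<open>y\<close> comes from some nonzero \<open>x\<close>, and
      the denominator is \<open>m * \<sigma> x\<close> with both factors nonzero.\<close>
    show "\<forall>y. y \<noteq> 0 \<longrightarrow> D * y - B * g y \<noteq> 0"
      using preimage by (metis \<sigma>_simps(5) mult_eq_0_iff)
    show "{\<sigma> (f x) / \<sigma> x | x. x \<noteq> 0} = {(A * g y - C * y) / (D * y - B * g y) | y. y \<noteq> 0}"
    proof (intro equalityI subsetI)
      fix v assume "v \<in> {\<sigma> (f x) / \<sigma> x | x. x \<noteq> 0}"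
      thus "v \<in> {(A * g y - C * y) / (D * y - B * g y) | y. y \<noteq> 0}"
        using image ratio by blast
    next
      fix v assume "v \<in> {(A * g y - C * y) / (D * y - B * g y) | y. y \<noteq> 0}"
      then obtain y where y: "y \<noteq> 0" "v = (A * g y - C * y) / (D * y - B * g y)" by blast
      from preimage[OF y(1)] obtain x m where "x \<noteq> 0" "m \<noteq> 0" "m * \<sigma> x = D * y - B * g y"
        "m * \<sigma> (f x) = A * g y - C * y" by blast
      thus "v \<in> {\<sigma> (f x) / \<sigma> x | x. x \<noteq> 0}" using ratio[of m x y] y(2) by force
    qed
  qed
qed

text \<open>Since \<sigma> commutes with powers, substituting \<open>\<sigma> x\<close> for the
  variable leaves a twist of the coefficient.\<close>

lemma slopes_automorphism:
  assumes "field_automorphism \<sigma>"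
  shows "{\<sigma> (\<delta> * x ^ i + x ^ j) / \<sigma> x | x. x \<noteq> 0} = slopes (\<lambda>x. \<sigma> \<delta> * x ^ i + x ^ j)"
proof -
  note s = field_automorphism_simps[OF assms]
  have "surj \<sigma>" using assms by (simp add: field_automorphism_def bij_is_surj)
  thus ?thesis by (subst slopes_reindex[of \<sigma>]) (simp_all add: s)
qed

text \<open>Used to derive that \<delta> and \<rho> are nonzero. The value 1 covers the empty
  exponent sum at \<open>n = 0\<close>.\<close>

lemma field_norm_0: "field_norm q n 0 \<in> {0, 1}"
  by (simp add: field_norm_def power_0_left)

theorem theorem3p4:
  fixes q :: nat
  assumes "primepow q"
  shows "(\<forall>n s. \<forall>\<delta> :: 'a::{field,finite}.
            CARD('a) = q ^ n \<and> n \<ge> 4 \<and> 1 \<le> s \<and> s \<le> n - 1 \<and> gcd s n = 1 \<and>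
            field_norm q n \<delta> \<notin> {0, 1} \<longrightarrow>
            \<not> pseudoregulus_type q (L2 q n s \<delta>)) \<and>
         (\<forall>\<delta> \<rho> :: 'b::{field,finite}.
            CARD('b) = q ^ 8 \<and> field_norm q 8 \<delta> \<notin> {0, 1} \<and> field_norm q 8 \<rho> \<notin> {0, 1} \<longrightarrow>
            \<not> PGammaL2_equivalent (L2 q 8 1 \<delta>) (L2 q 8 3 \<rho>))"
proof (intro conjI allI impI notI; elim conjE)
  fix n s and \<delta> :: 'a
  assume card: "CARD('a) = q ^ n" and n: "n \<ge> 4" and s: "1 \<le> s" "s \<le> n - 1" "gcd s n = 1"
    and norm: "field_norm q n \<delta> \<notin> {0, 1}" and pseudo: "pseudoregulus_type q (L2 q n s \<delta>)"
  interpret field_extension q n "TYPE('a)" by unfold_locales (fact assms card)+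
  have "\<delta> \<noteq> 0" using norm field_norm_0 by metis
  define f where "f = (\<lambda>x. \<delta> * x ^ (q ^ s) + x ^ (q ^ (n - s)))"
  define g :: "'a \<Rightarrow> 'a" where "g = (\<lambda>x. x ^ q)"
  have f0: "f 0 = 0" and g0: "g 0 = 0" using q_ge_2 by (simp_all add: f_def g_def)
  have "PGammaL2_equivalent (linear_set {vector [x, f x] | x. True})
      (linear_set {vector [x, g x] | x. True})"
    using pseudo unfolding pseudoregulus_type_def L1_def L2_def U1_def U2_def f_def g_def .
  from this f0 g0 obtain \<sigma> A B C D where \<sigma>: "field_automorphism \<sigma>" and det: "A * D - B * C \<noteq> 0"
    and inj: "\<forall>y. y \<noteq> 0 \<longrightarrow> D * y - B * g y \<noteq> 0"
    and eq: "{\<sigma> (f x) / \<sigma> x | x. x \<noteq> 0} =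
      {(A * g y - C * y) / (D * y - B * g y) | y. y \<noteq> 0}"
    by (rule PGammaL2_equivalent_slopes)
  have \<sigma>\<delta>: "\<sigma> \<delta> \<noteq> 0" using \<open>\<delta> \<noteq> 0\<close> field_automorphism_simps(5)[OF \<sigma>] by simp
  have sn: "s < n" "coprime s n" using s(2) n gcd_eq_1_imp_coprime[OF s(3)] by linarith+
  show False
    using slopes_neq_pseudoregulus[OF n s(1) sn \<sigma>\<delta> det inj[unfolded g_def, rule_format]] eq
    unfolding f_def g_def slopes_automorphism[OF \<sigma>] by (rule notE)
next
  fix \<delta> \<rho> :: 'b
  assume card: "CARD('b) = q ^ 8" and norm: "field_norm q 8 \<delta> \<notin> {0, 1}" "field_norm q 8 \<rho> \<notin> {0, 1}"
    and equiv: "PGammaL2_equivalent (L2 q 8 1 \<delta>) (L2 q 8 3 \<rho>)"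
  interpret field_extension q 8 "TYPE('b)" by unfold_locales (fact assms card)+
  have "\<delta> \<noteq> 0" "\<rho> \<noteq> 0" using norm field_norm_0 by metis+
  \<comment> \<open>The exponents 7 and 5 in \<open>f\<close> and \<open>g\<close> are
    \<open>8 - 1\<close> and \<open>8 - 3\<close>.\<close>
  define f where "f = (\<lambda>x. \<delta> * x ^ (q ^ 1) + x ^ (q ^ 7))"
  define g where "g = (\<lambda>x. \<rho> * x ^ (q ^ 3) + x ^ (q ^ 5))"
  have f0: "f 0 = 0" and g0: "g 0 = 0" using q_ge_2 by (simp_all add: f_def g_def)
  have "PGammaL2_equivalent (linear_set {vector [x, f x] | x. True})
      (linear_set {vector [x, g x] | x. True})"
    using equiv by (simp add: L2_def U2_def f_def g_def)
  from this f0 g0 obtain \<sigma> A B C D where \<sigma>: "field_automorphism \<sigma>" and det: "A * D - B * C \<noteq> 0"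
    and inj: "\<forall>y. y \<noteq> 0 \<longrightarrow> D * y - B * g y \<noteq> 0"
    and eq: "{\<sigma> (f x) / \<sigma> x | x. x \<noteq> 0} =
      {(A * g y - C * y) / (D * y - B * g y) | y. y \<noteq> 0}"
    by (rule PGammaL2_equivalent_slopes)
  have \<sigma>\<delta>: "\<sigma> \<delta> \<noteq> 0" using \<open>\<delta> \<noteq> 0\<close> field_automorphism_simps(5)[OF \<sigma>] by simp
  have g: "g x = \<rho> * x ^ (q ^ 3) + x ^ (q ^ 5)" for x by (simp add: g_def)
  show False
    using slopes_degree_8_neq[OF refl \<sigma>\<delta> \<open>\<rho> \<noteq> 0\<close> det g inj[rule_format]] eq
    unfolding f_def slopes_automorphism[OF \<sigma>] by (rule notE)
qed

end
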